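(* For every positive integer $k$ and every real $x\ge k+2$, $$R_k(x)<\frac{K(x)}{\Gamma(x+1)}\le\frac{P_{k-1}(x)+1}{P_{k-1}(x)}\cdot R_k(x),$$ and equality holds in the right-hand inequality for $x=k+2$.
   Context: $\Gamma$ is the gamma function. Kurepa's function is defined for real $x>0$ by $$K(x)=\int_0^\infty e^{-t}\,\frac{t^x-1}{t-1}\,dt .$$ The polynomials $P_n$ ($n\ge0$) are defined by $P_0(x)=1$ and $P_n(x)=(x-n)P_{n-1}(x)+1$ for $n\ge1$. The rational functions $R_n$ ($n\ge1$, defined for $x\notin\{0,1,\ldots,n-1\}$) are given by $R_1(x)=\frac1x$, $R_2(x)=\frac1{x-1}$ and, for $n\ge3$, $$R_n(x)=\frac{x-n+2}{x-n+1}R_{n-1}(x)-\frac{1}{x-n+1}R_{n-2}(x).$$ *)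

theory Defs
  imports "HOL-Analysis.Analysis"
begin

(* Only used for x > 0. The integrand has a removable singularity at t = 1, where division by zero
   gives it the value 0; a single point does not affect the integral. The integrand is
   nonnegative, so this integral agrees with the Lebesgue integral. *)
definition kurepa :: "real \<Rightarrow> real" where
  "kurepa x = integral {0..} (\<lambda>t. exp (- t) * ((t powr x - 1) / (t - 1)))"

fun P :: "nat \<Rightarrow> real \<Rightarrow> real" where
  "P 0 x = 1"
| "P (Suc n) x = (x - real (Suc n)) * P n x + 1"

(* The sequence starts at index 1; the value at index 0 is a dummy. In the last equation the
   index n of R is Suc (Suc (Suc m)), i.e. n >= 3. R n x is meaningful only for x outside
   {0, 1, ..., n - 1}; elsewhere a denominator vanishes. *)
fun R :: "nat \<Rightarrow> real \<Rightarrow> real" where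
  "R 0 x = 0"
| "R (Suc 0) x = 1 / x"
| "R (Suc (Suc 0)) x = 1 / (x - 1)"
| "R (Suc (Suc (Suc m))) x =
     (x - real (Suc (Suc (Suc m))) + 2) / (x - real (Suc (Suc (Suc m))) + 1) * R (Suc (Suc m)) x
     - 1 / (x - real (Suc (Suc (Suc m))) + 1) * R (Suc m) x"

end

theory Submission
  imports Defs
begin

text \<open>
  Write \<open>\<phi>\<^sub>a(t) = (t\<^sup>a - 1) / (t - 1)\<close>. Since \<open>K(x) = \<Gamma>(x) + K(x - 1)\<close> and
  \<open>R\<^sub>k(x) = (\<Gamma>(x) + \<dots> + \<Gamma>(x - k + 1)) / \<Gamma>(x + 1)\<close>, the difference
  \<open>K(x)/\<Gamma>(x + 1) - R\<^sub>k(x)\<close> equals \<open>K(x - k)/\<Gamma>(x + 1)\<close>. This is positive, and because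
  \<open>R\<^sub>k(x)/P\<^sub>k\<^sub>-\<^sub>1(x) = \<Gamma>(x - k + 1)/\<Gamma>(x + 1)\<close>, the upper bound amounts to
  \<open>K(z) \<le> \<Gamma>(z + 1)\<close> for \<open>z \<ge> 2\<close>, with equality at \<open>z = 2\<close>. With \<open>a = z - 1\<close> one has
  \<open>\<Gamma>(z + 1) - K(z) = \<integral> e\<^sup>-\<^sup>t t (t - 2) \<phi>\<^sub>a(t) dt\<close>. As \<open>\<phi>\<^sub>a\<close> is increasing by convexity of
  \<open>t\<^sup>a\<close>, replacing \<open>\<phi>\<^sub>a(t)\<close> by \<open>\<phi>\<^sub>a(2)\<close> does not increase the integrand, and
  \<open>\<integral> e\<^sup>-\<^sup>t t (t - 2) dt = \<Gamma>(3) - 2 \<Gamma>(2) = 0\<close>.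
\<close>

lemma Gamma_real_plus1: "x > 0 \<Longrightarrow> Gamma (x + 1) = x * Gamma (x::real)"
  by (rule Gamma_plus1) (auto elim!: nonpos_Ints_cases)

section \<open>Difference quotients of \<open>t powr a\<close> at base point 1\<close>

text \<open>Chord slopes of a convex function through a fixed point increase. The cases record where
  the base point 1 lies relative to \<open>s\<close> and \<open>t\<close>.\<close>

lemma powr_slope_mono:
  fixes s t a :: real
  assumes a: "a \<ge> 1" and s: "s > 0" "s \<noteq> 1" and t: "t \<noteq> 1" and st: "s \<le> t"
  shows "(s powr a - 1) / (s - 1) \<le> (t powr a - 1) / (t - 1)"
proof (cases "s = t")
  case False
  note slope = convex_on_slope_le[OF powr_convex[OF a]]
  have swap: "(1 - s powr a) / (1 - s) = (s powr a - 1) / (s - 1)"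
    if "s \<noteq> 1" for s :: real using that by (simp add: field_simps)
  consider "1 < s" | "s < 1" "1 < t" | "t < 1" using s t by linarith
  then show ?thesis
  proof cases
    case 1
    with False st slope(1)[of 1 t s] show ?thesis by (simp add: swap)
  next
    case 2
    with s slope[of s t 1] show ?thesis by (simp add: swap)
  next
    case 3
    with False st s slope(2)[of s 1 t] show ?thesis by simp
  qed
qed simp

lemma powr_slope_nonneg:
  fixes t a :: real
  assumes "a \<ge> 0" "t \<ge> 0"
  shows "(t powr a - 1) / (t - 1) \<ge> 0"
proof (cases "t \<ge> 1")
  case True
  with assms show ?thesis by (simp add: ge_one_powr_ge_zero)
next
  case False
  with assms have "t powr a \<le> 1" by (simp add: powr_le1)
  with False show ?thesis by (intro divide_nonpos_neg) auto
qed

text \<open>The weight \<open>t * (t - 2)\<close> changes sign at 2, exactly where the increasing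
  slope takes the value \<open>2 powr a - 1\<close>, so both sides of 2 give the same
  inequality.\<close>

lemma powr_slope_weighted_ge:
  fixes t a :: real
  assumes a: "a \<ge> 1" and t: "t \<ge> 0"
  shows "t * (t - 2) * (2 powr a - 1) \<le> t * (t - 2) * ((t powr a - 1) / (t - 1))"
proof -
  consider "t = 0" | "t = 1" | "t > 0" "t \<noteq> 1" "t \<le> 2" | "t > 2" using t by linarith
  then show ?thesis
  proof cases
    \<comment> \<open>Division by zero makes the slope 0 here, so the claim is just that
      \<open>2 powr a - 1\<close> is nonnegative.\<close>
    case 2
    have "(2::real) powr 0 \<le> 2 powr a" using a by (intro powr_mono) auto
    then show ?thesis using 2 by simp
  next
    case 3
    then have "(t powr a - 1) / (t - 1) \<le> 2 powr a - 1"
      using powr_slope_mono[OF a, of t 2] by simp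
    moreover have "t * (t - 2) \<le> 0" using 3 by (simp add: mult_nonneg_nonpos)
    ultimately show ?thesis by (rule mult_left_mono_neg)
  next
    case 4
    then have "2 powr a - 1 \<le> (t powr a - 1) / (t - 1)"
      using powr_slope_mono[OF a, of 2 t] by simp
    moreover have "t * (t - 2) \<ge> 0" using 4 by simp
    ultimately show ?thesis by (rule mult_left_mono)
  qed simp
qed

text \<open>Supplies an integrable majorant: monotonicity bounds the slope up to 2, and beyond 2 the
  denominator exceeds 1.\<close>

lemma powr_slope_le:
  fixes t a :: real
  assumes a: "a \<ge> 1" and t: "t \<ge> 0"
  shows "(t powr a - 1) / (t - 1) \<le> 2 powr a + t powr a"
proof -
  have two: "(2::real) powr a \<ge> 1" using a by (intro ge_one_powr_ge_zero) auto
  consider "t = 0" | "t = 1" | "t > 0" "t \<noteq> 1" "t \<le> 2" | "t > 2" using t by linarith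
  then show ?thesis
  proof cases
    case 3
    then have "(t powr a - 1) / (t - 1) \<le> 2 powr a - 1"
      using powr_slope_mono[OF a, of t 2] by simp
    also have "\<dots> \<le> 2 powr a + t powr a" using powr_ge_zero[of t a] by linarith
    finally show ?thesis .
  next
    case 4
    then have "t powr a \<ge> 1" using a by (intro ge_one_powr_ge_zero) auto
    then have "(t powr a - 1) / (t - 1) \<le> (t powr a - 1) / 1"
      using 4 by (intro divide_left_mono) auto
    also have "\<dots> \<le> 2 powr a + t powr a" using two by simp
    finally show ?thesis .
  qed (use two in auto)
qed

section \<open>Integrals for \<open>Gamma\<close> and \<open>kurepa\<close>\<close>

lemma exp_powr_has_integral:
  assumes "x > -1"
  shows "((\<lambda>t::real. exp (- t) * t powr x) has_integral Gamma (x + 1)) {0..}"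
  using Gamma_integral_real[of "x + 1"] assms by (simp add: exp_minus field_simps)

lemma exp_minus_has_integral: "((\<lambda>t::real. exp (- t)) has_integral 1) {0..}"
  \<comment> \<open>The point 0 is exceptional because \<open>0 powr 0 = 0\<close>.\<close>
  by (rule has_integral_spike_finite[OF _ _ exp_powr_has_integral[of 0, simplified], of "{0}"]) auto

lemma kurepa_has_integral:
  assumes x: "x \<ge> 1"
  shows "((\<lambda>t. exp (- t) * ((t powr x - 1) / (t - 1))) has_integral kurepa x) {0..}"
proof -
  have "((\<lambda>t. 2 powr x * exp (- t) + exp (- t) * t powr x)
      has_integral 2 powr x * 1 + Gamma (x + 1)) {0..}"
    using x by (intro has_integral_add has_integral_mult_right
        exp_minus_has_integral exp_powr_has_integral) auto
  then have g: "(\<lambda>t. 2 powr x * exp (- t) + exp (- t) * t powr x) integrable_on {0..}"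
    by blast
  have "(\<lambda>t. exp (- t) * ((t powr x - 1) / (t - 1))) integrable_on {0..}"
  proof (rule measurable_bounded_by_integrable_imp_integrable[OF _ g])
    show "(\<lambda>t. exp (- t) * ((t powr x - 1) / (t - 1))) \<in> borel_measurable (lebesgue_on {0..})"
      by (intro measurable_restrict_space1 measurable_completion) measurable
    show "norm (exp (- t) * ((t powr x - 1) / (t - 1)))
        \<le> 2 powr x * exp (- t) + exp (- t) * t powr x" if "t \<in> {0..}" for t
    proof -
      have "norm (exp (- t) * ((t powr x - 1) / (t - 1))) = exp (- t) * ((t powr x - 1) / (t - 1))"
        using powr_slope_nonneg[of x t] x that
        by (simp add: abs_mult del: times_divide_eq_right abs_divide)
      also have "\<dots> \<le> exp (- t) * (2 powr x + t powr x)"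
        using powr_slope_le[of x t] x that by (intro mult_left_mono) auto
      finally show ?thesis by (simp add: algebra_simps)
    qed
  qed auto
  then show ?thesis unfolding kurepa_def by (rule integrable_integral)
qed

lemma kurepa_nonneg:
  assumes "x \<ge> 1"
  shows "kurepa x \<ge> 0"
  using kurepa_has_integral[OF assms]
  by (rule has_integral_nonneg)
     (use assms in \<open>auto intro!: mult_nonneg_nonneg powr_slope_nonneg simp del: times_divide_eq_right\<close>)

lemma kurepa_1: "kurepa 1 = 1"
proof (rule has_integral_unique[OF kurepa_has_integral])
  show "((\<lambda>t::real. exp (- t) * ((t powr 1 - 1) / (t - 1))) has_integral 1) {0..}"
    by (rule has_integral_spike_finite[OF _ _ exp_minus_has_integral, of "{1}"]) auto
qed simp

lemma kurepa_rec:
  assumes "x \<ge> 2"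
  shows "kurepa x = Gamma x + kurepa (x - 1)"
proof (rule has_integral_unique[OF kurepa_has_integral])
  have "((\<lambda>t. exp (- t) * t powr (x - 1) + exp (- t) * ((t powr (x - 1) - 1) / (t - 1)))
      has_integral Gamma (x - 1 + 1) + kurepa (x - 1)) {0..}"
    using assms by (intro has_integral_add exp_powr_has_integral kurepa_has_integral) auto
  then have int: "((\<lambda>t. exp (- t) * t powr (x - 1) + exp (- t) * ((t powr (x - 1) - 1) / (t - 1)))
      has_integral Gamma x + kurepa (x - 1)) {0..}" by simp
  show "((\<lambda>t. exp (- t) * ((t powr x - 1) / (t - 1))) has_integral Gamma x + kurepa (x - 1)) {0..}"
  \<comment> \<open>At \<open>t = 1\<close> the integrands differ: the left one is 0 by division by
    zero, the right one is \<open>exp (- 1)\<close>.\<close>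
  proof (rule has_integral_spike_finite[OF _ _ int, of "{1}"])
    fix t :: real assume t: "t \<in> {0..} - {1}"
    have "t powr x = t * t powr (x - 1)"
      using t powr_mult_base[of t "x - 1"] by simp
    then have "(t powr x - 1) / (t - 1) = t powr (x - 1) + (t powr (x - 1) - 1) / (t - 1)"
      using t by (simp add: field_simps)
    then show "exp (- t) * ((t powr x - 1) / (t - 1)) =
        exp (- t) * t powr (x - 1) + exp (- t) * ((t powr (x - 1) - 1) / (t - 1))"
      by (simp add: distrib_left)
  qed simp
qed (use assms in simp)

section \<open>Bounds for \<open>kurepa\<close>\<close>

lemma kurepa_pos:
  assumes "x \<ge> 2"
  shows "kurepa x > 0"
  using kurepa_rec[OF assms] kurepa_nonneg[of "x - 1"] Gamma_real_pos[of x] assms by linarith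

lemma kurepa_2: "kurepa 2 = Gamma 3"
  using kurepa_rec[of 2] Gamma_real_plus1[of 1] Gamma_real_plus1[of 2] by (simp add: kurepa_1)

lemma kurepa_le_Gamma:
  assumes z: "z \<ge> 2"
  shows "kurepa z \<le> Gamma (z + 1)"
proof -
  define a where "a = z - 1"
  have a: "a \<ge> 1" "z = a + 1" using z by (auto simp: a_def)
  define c :: real where "c = 2 powr a - 1"
  define \<phi> where "\<phi> t = (t powr a - 1) / (t - 1)" for t :: real
  have [simp]: "Gamma (3::real) = 2" "Gamma (2::real) = 1"
    using Gamma_real_plus1[of 1] Gamma_real_plus1[of 2] by simp_all
  \<comment> \<open>This is \<open>exp (- t) * t * (t - 2) * (\<phi> t - c)\<close> expanded into
    terms with known integrals; the coefficient of \<open>c\<close> integrates to 0.\<close>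
  have int: "((\<lambda>t. exp (- t) * t powr (a + 1) - exp (- t) * t powr a - exp (- t) * t powr 1
        + exp (- t) - exp (- t) * \<phi> t - c * (exp (- t) * t powr 2 - 2 * (exp (- t) * t powr 1)))
      has_integral Gamma (a + 1 + 1) - Gamma (a + 1) - Gamma (1 + 1) + 1 - kurepa a
        - c * (Gamma (2 + 1) - 2 * Gamma (1 + 1))) {0..}"
    unfolding \<phi>_def using a
    by (intro has_integral_add has_integral_diff has_integral_mult_right
        exp_powr_has_integral exp_minus_has_integral kurepa_has_integral) auto
  have "0 \<le> Gamma (a + 1 + 1) - Gamma (a + 1) - Gamma (1 + 1) + 1 - kurepa a
        - c * (Gamma (2 + 1) - 2 * Gamma (1 + 1))"
  proof (rule has_integral_nonneg[OF int])
    fix t :: real assume "t \<in> {0..}"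
    then have t: "t \<ge> 0" by simp
    have p: "t powr (1 + a) = t * t powr a" "t powr 2 = t * t"
      using t powr_mult_base[of t a] by (simp_all add: power2_eq_square)
    \<comment> \<open>Uses \<open>t * (t - 2) = (t - 1)^2 - 1\<close>; at \<open>t = 1\<close> both
      sides vanish since \<open>\<phi> 1 = 0\<close>.\<close>
    have \<phi>: "t * (t - 2) * \<phi> t = (t - 1) * (t powr a - 1) - \<phi> t"
    proof (cases "t = 1")
      case False
      then show ?thesis by (simp add: \<phi>_def field_simps)
    qed (simp add: \<phi>_def)
    have "exp (- t) * t powr (a + 1) - exp (- t) * t powr a - exp (- t) * t powr 1
          + exp (- t) - exp (- t) * \<phi> t - c * (exp (- t) * t powr 2 - 2 * (exp (- t) * t powr 1))
        = exp (- t) * (t * (t - 2) * \<phi> t - t * (t - 2) * c)"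
      unfolding \<phi> using t by (simp add: p algebra_simps)
    moreover have "t * (t - 2) * c \<le> t * (t - 2) * \<phi> t"
      unfolding c_def \<phi>_def by (rule powr_slope_weighted_ge[OF a(1) t])
    ultimately show "0 \<le> exp (- t) * t powr (a + 1) - exp (- t) * t powr a - exp (- t) * t powr 1
          + exp (- t) - exp (- t) * \<phi> t - c * (exp (- t) * t powr 2 - 2 * (exp (- t) * t powr 1))"
      by simp
  qed
  then show ?thesis using kurepa_rec[OF z] a by simp
qed

section \<open>Closed forms in terms of \<open>P\<close>\<close>

text \<open>After scaling by \<open>Gamma\<close>, the recurrence of \<open>R\<close> becomes a
  three-term recurrence that \<open>P\<close> satisfies too. It reaches back two indices, hence
  strong induction with two base cases.\<close>

lemma R_conv_P: "x > real m \<Longrightarrow> R (Suc m) x = P m x * Gamma (x - real m) / Gamma (x + 1)"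
proof (induction m rule: less_induct)
  case (less m)
  have Gx: "Gamma (x + 1) = x * Gamma x" and x0: "x > 0" "Gamma x \<noteq> 0"
    using less.prems Gamma_real_pos[of x] Gamma_real_plus1[of x] by linarith+
  consider "m = 0" | "m = 1" | n where "m = Suc (Suc n)"
    by (metis One_nat_def not0_implies_Suc)
  then show ?case
  proof cases
    case 1
    with x0 show ?thesis by (simp add: Gx)
  next
    case 2
    then have "Gamma x = (x - 1) * Gamma (x - 1)"
      using less.prems Gamma_real_plus1[of "x - 1"] by simp
    with 2 x0 show ?thesis by (simp add: Gx)
  next
    case (3 n)
    define u where "u = x - real n - 2"
    have u: "u > 0" "x - real m = u" "x - real n = u + 2" "x - real (Suc n) = u + 1"
      using less.prems 3 by (auto simp: u_def)
    have G1: "Gamma (u + 1) = u * Gamma u" "Gamma (u + 2) = (u + 1) * (u * Gamma u)"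
      using Gamma_real_plus1[of u] Gamma_real_plus1[of "u + 1"] u(1) by (auto simp: add.assoc)
    have IH: "R (Suc n) x = P n x * Gamma (u + 2) / Gamma (x + 1)"
      "R (Suc (Suc n)) x = P (Suc n) x * Gamma (u + 1) / Gamma (x + 1)"
      using less.IH[of n, unfolded u(3)] less.IH[of "Suc n", unfolded u(4)] 3 less.prems by auto
    have Pn: "P (Suc n) x = (u + 1) * P n x + 1" "P m x = u * P (Suc n) x + 1"
      using P.simps(2)[of n x] P.simps(2)[of "Suc n" x] u(2,4) unfolding 3 by metis+
    have "R (Suc m) x = (u + 1) / u * R (Suc (Suc n)) x - 1 / u * R (Suc n) x"
    proof -
      have "x - real (Suc (Suc (Suc n))) + 2 = u + 1" "x - real (Suc (Suc (Suc n))) + 1 = u"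
        by (auto simp: u_def)
      then show ?thesis unfolding 3 R.simps(4)[of n] by metis
    qed
    also have "\<dots> = (u + 1) * (P (Suc n) x - P n x) * Gamma u / Gamma (x + 1)"
      unfolding IH G1 using u(1)
      by (simp add: diff_divide_distrib left_diff_distrib right_diff_distrib mult_ac del: P.simps)
    \<comment> \<open>Eliminates the constant 1 between two consecutive instances of the recurrence
      of \<open>P\<close>.\<close>
    also have "(u + 1) * (P (Suc n) x - P n x) = P m x"
      using Pn by algebra
    finally show ?thesis unfolding u(2) .
  qed
qed

text \<open>Iterates \<open>kurepa_rec\<close>; the functional equation of \<open>Gamma\<close>
  collects the sum of \<open>Gamma (x - real i)\<close> for \<open>i\<close> up to \<open>m\<close>
  into one multiple of the last term. The bound on \<open>x\<close> keeps every argument used at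
  least 2.\<close>

lemma kurepa_unroll:
  "x \<ge> real m + 2 \<Longrightarrow> kurepa x = P m x * Gamma (x - real m) + kurepa (x - real (Suc m))"
proof (induction m)
  case 0
  then show ?case using kurepa_rec[of x] by simp
next
  case (Suc m)
  define u where "u = x - real (Suc m)"
  have u: "u \<ge> 2" "x - real m = u + 1" "x - real (Suc (Suc m)) = u - 1"
    using Suc.prems by (auto simp: u_def)
  have "kurepa x = P m x * Gamma (u + 1) + kurepa u"
    using Suc.IH[unfolded u(2), folded u_def] Suc.prems by simp
  also have "\<dots> = P m x * (u * Gamma u) + (Gamma u + kurepa (u - 1))"
    using Gamma_real_plus1[of u] kurepa_rec[of u] u(1) by simp
  also have "\<dots> = P (Suc m) x * Gamma u + kurepa (u - 1)"
    unfolding P.simps(2) u_def[symmetric] by (simp add: algebra_simps)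
  finally show ?case unfolding u(3) u_def[symmetric] .
qed

lemma P_pos: "x \<ge> real m \<Longrightarrow> P m x > 0"
  by (induction m) (auto intro!: add_nonneg_pos mult_nonneg_nonneg simp: less_imp_le)

theorem theorem4p5:
  fixes k :: nat
  assumes "k \<ge> 1"
  shows "(\<forall>x::real. x \<ge> real k + 2 \<longrightarrow>
            R k x < kurepa x / Gamma (x + 1) \<and>
            kurepa x / Gamma (x + 1) \<le> (P (k - 1) x + 1) / P (k - 1) x * R k x) \<and>
         kurepa (real k + 2) / Gamma ((real k + 2) + 1) =
            (P (k - 1) (real k + 2) + 1) / P (k - 1) (real k + 2) * R k (real k + 2)"
proof -
  obtain m where k: "k = Suc m" using assms by (cases k) auto
  \<comment> \<open>Both quantities are split as \<open>R k x\<close> plus a remainder, which leaves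
    \<open>kurepa z\<close> to be compared with 0 and with \<open>Gamma (z + 1)\<close> at
    \<open>z = x - real k\<close>.\<close>
  have K: "kurepa x / Gamma (x + 1) = R k x + kurepa (x - real k) / Gamma (x + 1)"
    and U: "(P (k - 1) x + 1) / P (k - 1) x * R k x
      = R k x + Gamma (x - real k + 1) / Gamma (x + 1)"
    if "x \<ge> real k + 2" for x
  proof -
    have R: "R k x = P m x * Gamma (x - real m) / Gamma (x + 1)"
      using that R_conv_P[of m x] by (simp add: k)
    show "kurepa x / Gamma (x + 1) = R k x + kurepa (x - real k) / Gamma (x + 1)"
      using kurepa_unroll[of m x] that unfolding R by (simp add: k add_divide_distrib)
    have "P m x > 0" using P_pos[of m x] that by (simp add: k)
    \<comment> \<open>The extra term is \<open>R k x / P m x\<close>, and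
      \<open>x - real m = x - real k + 1\<close>.\<close>
    then show "(P (k - 1) x + 1) / P (k - 1) x * R k x
        = R k x + Gamma (x - real k + 1) / Gamma (x + 1)"
      unfolding R by (simp add: k add_divide_distrib distrib_right)
  qed
  have "R k x < kurepa x / Gamma (x + 1) \<and>
      kurepa x / Gamma (x + 1) \<le> (P (k - 1) x + 1) / P (k - 1) x * R k x"
    if x: "x \<ge> real k + 2" for x
  proof -
    have "Gamma (x + 1) > 0" using x by simp
    then show ?thesis
      unfolding K[OF x] U[OF x] using x kurepa_pos[of "x - real k"] kurepa_le_Gamma[of "x - real k"]
      by (simp add: divide_right_mono)
  qed
  moreover have "kurepa (real k + 2) / Gamma ((real k + 2) + 1) =
      (P (k - 1) (real k + 2) + 1) / P (k - 1) (real k + 2) * R k (real k + 2)"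
    unfolding K[OF order.refl] U[OF order.refl] by (simp add: kurepa_2)
  ultimately show ?thesis by blast
qed

end
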